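(* If $\mathcal{F} \subseteq \binom{[n]}{2}$ is $(3,4)$-conditionally intersecting but is not intersecting, then \[ |\mathcal{F}| \leq n-2, \] and equality holds if and only if $\mathcal{F}$ is a twin 2-star.
   Context: $[n]=\{1,\ldots,n\}$ and $\binom{[n]}{2}$ is the family of all $2$-element subsets of $[n]$. A family $\mathcal{F}$ is $(3,4)$-conditionally intersecting if, for all distinct sets $A_1,A_2,A_3\in\mathcal{F}$, $A_1\cap A_2\cap A_3\neq\emptyset$ whenever $|A_1\cup A_2\cup A_3|\leq 4$. A family $\mathcal{F}$ is intersecting if $A\cap B\neq\emptyset$ for all $A,B\in\mathcal{F}$. A twin 2-star on $[n]$ is any family $\mathcal{F} \subseteq \binom{[n]}{2}$ consisting, for some distinct fixed $x,y \in [n]$, of $n-2$ unordered pairs of the form $\{z,z'\}$ with $z\in [n]\setminus\{x,y\}$ and $z'\in\{x,y\}$, such that each element $z\in [n]\setminus\{x,y\}$ appears in exactly one member of $\mathcal{F}$. *)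

theory Defs
  imports Main "HOL-Library.Ramsey"
begin

(* The finiteness conjunct is needed only because card is 0 on infinite sets;
   it holds automatically for families of finite sets. *)
definition conditionally_intersecting_3_4 :: "'a set set \<Rightarrow> bool" where
  "conditionally_intersecting_3_4 F \<longleftrightarrow>
     (\<forall>A\<in>F. \<forall>B\<in>F. \<forall>C\<in>F. A \<noteq> B \<and> A \<noteq> C \<and> B \<noteq> C \<longrightarrow>
        finite (A \<union> B \<union> C) \<and> card (A \<union> B \<union> C) \<le> 4 \<longrightarrow> A \<inter> B \<inter> C \<noteq> {})"

definition intersecting :: "'a set set \<Rightarrow> bool" where
  "intersecting F \<longleftrightarrow> (\<forall>A\<in>F. \<forall>B\<in>F. A \<inter> B \<noteq> {})"

(* A star may be empty: all z are allowed to be joined to x, or all to y. *)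
definition twin_2_star :: "nat \<Rightarrow> nat set set \<Rightarrow> bool" where
  "twin_2_star n F \<longleftrightarrow>
     F \<subseteq> [{1..n}]\<^bsup>2\<^esup> \<and>
     (\<exists>x\<in>{1..n}. \<exists>y\<in>{1..n}. x \<noteq> y \<and>
        card F = n - 2 \<and>
        (\<forall>A\<in>F. \<exists>z\<in>{1..n} - {x, y}. \<exists>z'\<in>{x, y}. A = {z, z'}) \<and>
        (\<forall>z\<in>{1..n} - {x, y}. \<exists>!A. A \<in> F \<and> z \<in> A))"

end

theory Submission
  imports Defs
begin

text \<open>
  Viewed as a graph, \<open>F\<close> contains neither a triangle nor a path with three edges, so every edge
  has an end lying on no other edge. Choosing such a leaf in each edge is injective, and the
  other end of an edge is never a chosen leaf. Two disjoint edges thus give two vertices \<open>x\<close>, \<open>y\<close>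
  that are not leaves, hence \<open>card F \<le> n - 2\<close>. In case of equality all vertices
  except \<open>x\<close> and \<open>y\<close> are leaves, so every edge joins its leaf to \<open>x\<close> or \<open>y\<close>.
\<close>

lemma conditionally_intersecting_3_4_leaf:
  assumes F: "conditionally_intersecting_3_4 F"
    and two: "\<And>B. B \<in> F \<Longrightarrow> card B = 2"
    and A: "A \<in> F"
  shows "\<exists>u v. A = {u, v} \<and> u \<noteq> v \<and> (\<forall>B\<in>F. u \<in> B \<longrightarrow> B = A)"
proof (rule ccontr)
  assume no_leaf: "\<not> ?thesis"
  obtain p q where pq: "A = {p, q}" "p \<noteq> q"
    using two[OF A] by (auto simp: card_2_iff)
  obtain B where B: "B \<in> F" "p \<in> B" "B \<noteq> A"
    using no_leaf pq by blast
  obtain C where C: "C \<in> F" "q \<in> C" "C \<noteq> A"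
    using no_leaf pq by (metis insert_commute)
  obtain r where r: "B = {p, r}" "r \<noteq> p"
    using two[OF B(1)] B(2) by (auto simp: card_2_iff)
  obtain s where s: "C = {q, s}" "s \<noteq> q"
    using two[OF C(1)] C(2) by (auto simp: card_2_iff)
  have rs: "r \<noteq> q" "s \<noteq> p"
    using B(3) C(3) r s pq by auto
  \<comment> \<open>The list may repeat a vertex: \<open>r = s\<close> is the triangle,
    \<open>r \<noteq> s\<close> the path. The length bounds the cardinality in both cases.\<close>
  have "A \<union> B \<union> C = set [p, q, r, s]"
    using pq r s by auto
  then have "finite (A \<union> B \<union> C)" "card (A \<union> B \<union> C) \<le> 4"
    using card_length[of "[p, q, r, s]"] by simp_all
  moreover have "B \<noteq> C" "A \<inter> B \<inter> C = {}"
    using pq r s rs by auto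
  ultimately show False
    using F A B(1,3) C(1,3) unfolding conditionally_intersecting_3_4_def by metis
qed

theorem proposition14:
  fixes n :: nat and F :: "nat set set"
  assumes "F \<subseteq> [{1..n}]\<^bsup>2\<^esup>"
    and "conditionally_intersecting_3_4 F"
    and "\<not> intersecting F"
  shows "card F \<le> n - 2 \<and> (card F = n - 2 \<longleftrightarrow> twin_2_star n F)"
proof -
  have sub: "A \<subseteq> {1..n}" and two: "card A = 2" if "A \<in> F" for A
    using assms(1) that by (auto simp: nsets_def)
  have "\<forall>A\<in>F. \<exists>u v. A = {u, v} \<and> u \<noteq> v \<and> (\<forall>B\<in>F. u \<in> B \<longrightarrow> B = A)"
    using conditionally_intersecting_3_4_leaf[OF assms(2) two] by blast
  \<comment> \<open>If both ends of an edge are leaves, the choice is arbitrary: one becomes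
    \<open>l A\<close>, the other counts as the centre \<open>c A\<close>.\<close>
  then obtain l c where
    "\<forall>A\<in>F. A = {l A, c A} \<and> l A \<noteq> c A \<and> (\<forall>B\<in>F. l A \<in> B \<longrightarrow> B = A)"
    unfolding bchoice_iff by (elim exE)
  then have ends: "A = {l A, c A}" and neq: "l A \<noteq> c A"
    and leaf: "B \<in> F \<Longrightarrow> l A \<in> B \<Longrightarrow> B = A" if "A \<in> F" for A B
    using that by metis+
  have leaf_in: "l A \<in> A" and centre_in: "c A \<in> A" if "A \<in> F" for A
    using ends[OF that] by (metis insertI1 insertI2)+
  have inj: "inj_on l F"
    by (rule inj_onI) (metis leaf leaf_in)
  \<comment> \<open>If \<open>c A = l B\<close>, the leaf of \<open>B\<close> lies in
    \<open>A\<close>, so \<open>A = B\<close> and the two ends of \<open>A\<close> coincide.\<close>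
  have centre: "c A \<notin> l ` F" if "A \<in> F" for A
  proof
    assume "c A \<in> l ` F"
    then obtain B where "B \<in> F" "c A = l B" by blast
    then show False
      using that centre_in leaf neq by metis
  qed
  obtain A B where AB: "A \<in> F" "B \<in> F" "A \<inter> B = {}"
    using assms(3) unfolding intersecting_def by blast
  define x y where "x = c A" and "y = c B"
  \<comment> \<open>The centres differ because \<open>A\<close> and \<open>B\<close> are
    disjoint.\<close>
  have xy: "x \<in> {1..n}" "y \<in> {1..n}" "x \<noteq> y"
    using sub[OF AB(1)] sub[OF AB(2)] centre_in[OF AB(1)] centre_in[OF AB(2)] AB(3)
    unfolding x_def y_def by auto
  have L: "l ` F \<subseteq> {1..n} - {x, y}"
  proof (rule image_subsetI)
    fix E assume E: "E \<in> F"
    then have "l E \<noteq> c A" "l E \<noteq> c B"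
      using centre[OF AB(1)] centre[OF AB(2)] by (metis imageI)+
    then show "l E \<in> {1..n} - {x, y}"
      using sub[OF E] leaf_in[OF E] unfolding x_def y_def by auto
  qed
  have cardV: "card ({1..n} - {x, y}) = n - 2"
    using xy by (simp add: card_Diff_subset)
  have le: "card F \<le> n - 2"
    using card_mono[OF _ L] card_image[OF inj] cardV by simp
  have "twin_2_star n F" if eq: "card F = n - 2"
  proof -
    have L_eq: "l ` F = {1..n} - {x, y}"
      using card_subset_eq[OF _ L] card_image[OF inj] cardV eq by simp
    have edge: "\<exists>z\<in>{1..n} - {x, y}. \<exists>z'\<in>{x, y}. E = {z, z'}" if E: "E \<in> F" for E
    proof -
      have "l E \<in> {1..n} - {x, y}"
        using L E by blast
      \<comment> \<open>Every vertex other than \<open>x\<close> and \<open>y\<close> is now a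
        chosen leaf, which \<open>c E\<close> cannot be.\<close>
      moreover have "c E \<in> {x, y}"
        using L_eq centre[OF E] sub[OF E] centre_in[OF E] by auto
      ultimately show ?thesis
        using ends[OF E] by metis
    qed
    have unique: "\<exists>!E. E \<in> F \<and> z \<in> E" if z: "z \<in> {1..n} - {x, y}" for z
    proof -
      obtain E where "E \<in> F" "z = l E"
        using z L_eq by blast
      then show ?thesis
        using leaf leaf_in by metis
    qed
    show ?thesis
      unfolding twin_2_star_def
      by (intro conjI assms(1) bexI[OF _ xy(1)] bexI[OF _ xy(2)] xy(3) eq ballI edge unique)
  qed
  \<comment> \<open>The converse is immediate: the cardinality is part of
    \<open>twin_2_star\<close>.\<close>
  then show ?thesis
    using le by (auto simp: twin_2_star_def)
qed

end
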